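(* Suppose that the datapoints $(Z_i)_{i\ge1}$ are i.i.d. copies of a random element $Z_0$. Let $(\bar h_n)_n$ be a sequence of real-valued functions on $\mathcal Z$ with $\sigma_n^2=\operatorname{Var}(\bar h_n(Z_0))\in(0,\infty)$, and write $$T_n=\frac{1}{\sigma_n\sqrt n}\sum_{j=1}^k\sum_{i\in B_j'}\Big(h_n(Z_i,Z_{B_j})-\mathbb E[h_n(Z_i,Z_{B_j})\mid Z_{B_j}]-\big(\bar h_n(Z_i)-\mathbb E[\bar h_n(Z_i)]\big)\Big).$$ (1) If for some $q\in(0,2]$ $$\max(k^{q/2},k^{1-q/2})\;\mathbb E\Big[\Big(\frac{1}{\sigma_n^2}\operatorname{Var}_{Z_0}\big(h_n(Z_0,Z_{1:n(1-1/k)})-\bar h_n(Z_0)\big)\Big)^{q/2}\Big]\to0\quad (n\to\infty),$$ then $T_n\to0$ in $L^q$, i.e. $\mathbb E[|T_n|^q]\to0$. (2) If $$\mathbb E\Big[\min\Big(k,\ \frac{\sqrt k}{\sigma_n}\sqrt{\operatorname{Var}_{Z_0}\big(h_n(Z_0,Z_{1:n(1-1/k)})-\bar h_n(Z_0)\big)}\Big)\Big]\to0\quad (n\to\infty),$$ then $T_n\to0$ in probability.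
   Context: $(Z_i)_{i\ge1}$ is a sequence of random elements of a (measurable) set $\mathcal Z$; $Z_0$ is independent of $(Z_i)_{i\ge1}$. For each sample size $n$, $k=k_n\ge 2$ is a number of folds, possibly depending on $n$, which divides $n$ evenly, and $\{(B_j,B_j')\}_{j=1}^k$ are (non-random) train-validation splits: $B_j$ and $B_j'$ are vectors of distinct indices in $[n]=\{1,\dots,n\}$ which together partition $[n]$, and the validation index vectors $B_1',\dots,B_k'$ partition $[n]$ into $k$ folds of size $n/k$. For a vector $B$ of indices, $Z_B$ is the subvector of $Z_{1:n}=(Z_1,\dots,Z_n)$ with the ordered indices in $B$. $h_n$ is a real-valued (measurable) loss function taking a test point and a training vector of length $n(1-1/k)$ (not assumed symmetric in the training points), and all expectations that appear are assumed to be well defined. For independent $X,Y$, $\operatorname{Var}_X(f(X,Y))=\operatorname{Var}(f(X,Y)\mid Y)$; thus $\operatorname{Var}_{Z_0}$ is the variance over $Z_0$ only, conditionally on the training data. *)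

theory Defs
  imports "HOL-Probability.Probability"
begin

(* Positions are 0-based: entry i of subvec Z [b0, b1, ...] is Z b_i, so the result lies in
   the space of PiM {..<length bs} (\<lambda>_. N) whenever all Z b take values in space N. *)
definition subvec :: "(nat \<Rightarrow> 'a \<Rightarrow> 'z) \<Rightarrow> nat list \<Rightarrow> 'a \<Rightarrow> nat \<Rightarrow> 'z" where
  "subvec Z bs \<omega> = (\<lambda>i\<in>{..<length bs}. Z (bs ! i) \<omega>)"

definition vec_space :: "'z measure \<Rightarrow> nat \<Rightarrow> (nat \<Rightarrow> 'z) measure" where
  "vec_space N m = PiM {..<m} (\<lambda>_. N)"

definition sigma_subvec ::
  "'a measure \<Rightarrow> 'z measure \<Rightarrow> (nat \<Rightarrow> 'a \<Rightarrow> 'z) \<Rightarrow> nat list \<Rightarrow> 'a measure" where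
  "sigma_subvec M N Z bs =
     vimage_algebra (space M) (subvec Z bs) (vec_space N (length bs))"

(* Conditional variance E[(X - E[X | F])^2 | F], with values in [0, \<infinity>]; meaningful as soon as
   E[|X| | F] is finite almost everywhere, X itself need not be integrable. *)
definition cond_var :: "'a measure \<Rightarrow> 'a measure \<Rightarrow> ('a \<Rightarrow> real) \<Rightarrow> 'a \<Rightarrow> ennreal" where
  "cond_var M F X = nn_cond_exp M F (\<lambda>\<omega>. ennreal ((X \<omega> - real_cond_exp M F X \<omega>)\<^sup>2))"

(* Only used for exponents p > 0, where \<infinity> to the power p is \<infinity>. *)
definition epowr :: "ennreal \<Rightarrow> real \<Rightarrow> ennreal" where
  "epowr x p = (if x = \<infinity> then \<infinity> else ennreal (enn2real x powr p))"

definition cv_splits ::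
  "nat \<Rightarrow> nat \<Rightarrow> (nat \<Rightarrow> nat list) \<Rightarrow> (nat \<Rightarrow> nat list) \<Rightarrow> bool" where
  "cv_splits n k B B' \<longleftrightarrow>
     (\<forall>j\<in>{1..k}. distinct (B j) \<and> distinct (B' j) \<and>
        set (B j) \<inter> set (B' j) = {} \<and> set (B j) \<union> set (B' j) = {1..n} \<and>
        length (B' j) = n div k) \<and>
     disjoint_family_on (\<lambda>j. set (B' j)) {1..k} \<and>
     (\<Union>j\<in>{1..k}. set (B' j)) = {1..n}"

definition train_len :: "nat \<Rightarrow> nat \<Rightarrow> nat" where
  "train_len n k = n - n div k"

(* Var_{Z_0}(h(Z_0, Z_{1:m}) - g(Z_0)), the variance given Z_{1:m}. *)
definition var_Z0 ::
  "'a measure \<Rightarrow> 'z measure \<Rightarrow> (nat \<Rightarrow> 'a \<Rightarrow> 'z) \<Rightarrow> nat \<Rightarrow> ('z \<Rightarrow> (nat \<Rightarrow> 'z) \<Rightarrow> real) \<Rightarrow>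
     ('z \<Rightarrow> real) \<Rightarrow> 'a \<Rightarrow> ennreal" where
  "var_Z0 M N Z m h g =
     cond_var M (sigma_subvec M N Z [1..<Suc m])
       (\<lambda>\<omega>. h (Z 0 \<omega>) (subvec Z [1..<Suc m] \<omega>) - g (Z 0 \<omega>))"

definition cv_stat ::
  "'a measure \<Rightarrow> 'z measure \<Rightarrow> (nat \<Rightarrow> 'a \<Rightarrow> 'z) \<Rightarrow> nat \<Rightarrow> nat \<Rightarrow> (nat \<Rightarrow> nat list) \<Rightarrow>
     (nat \<Rightarrow> nat list) \<Rightarrow> ('z \<Rightarrow> (nat \<Rightarrow> 'z) \<Rightarrow> real) \<Rightarrow> ('z \<Rightarrow> real) \<Rightarrow> real \<Rightarrow> 'a \<Rightarrow> real" where
  "cv_stat M N Z n k B B' h g \<sigma> \<omega> =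
     1 / (\<sigma> * sqrt (real n)) *
     (\<Sum>j\<in>{1..k}. \<Sum>i\<in>set (B' j).
        h (Z i \<omega>) (subvec Z (B j) \<omega>)
        - real_cond_exp M (sigma_subvec M N Z (B j)) (\<lambda>\<omega>'. h (Z i \<omega>') (subvec Z (B j) \<omega>')) \<omega>
        - (g (Z i \<omega>) - prob_space.expectation M (\<lambda>\<omega>'. g (Z i \<omega>'))))"

end

theory Submission
  imports Defs
begin

text \<open>
  Given its training data, a fold sum is a sum of \<open>n/k\<close> i.i.d. centered terms, so its conditional
  second moment is \<open>n/k\<close> times \<open>Var\<^bsub>Z\<^sub>0\<^esub>\<close> and, by Jensen, its conditional moment of order \<open>p \<le> 2\<close>
  is at most the power \<open>p/2\<close> of that. All folds have the same distribution of the training data.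
  For (1), \<open>|\<Sum>\<^sub>j x\<^sub>j|\<^sup>q \<le> max 1 (k\<^bsup>q-1\<^esup>) \<Sum>\<^sub>j |x\<^sub>j|\<^sup>q\<close> reduces \<open>T\<^sub>n\<close> to single folds without any
  independence between folds. For (2), let \<open>R\<^sub>j\<close> be the quantity compared with \<open>k\<close> in the hypothesis;
  a union bound on \<open>R\<^sub>j > k\<close> and Markov's inequality on the folds with \<open>R\<^sub>j \<le> k\<close> give
  \<open>P(|T\<^sub>n| > \<epsilon>) \<le> (1 + 1/\<epsilon>) E min(k, R)\<close>.
\<close>

subsection \<open>Power inequalities\<close>

text \<open>Young's inequality for positive arguments, extended to the boundary, where
  \<open>0 powr \<alpha> = 0\<close> makes the left side vanish. It supplies the tangent-line
  estimates behind both the power-mean inequality and Jensen's inequality below.\<close>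

lemma weighted_arith_geo_mean:
  fixes a b :: real
  assumes "0 \<le> a" "0 \<le> b" "0 \<le> \<alpha>" "\<alpha> \<le> 1"
  shows "a powr \<alpha> * b powr (1 - \<alpha>) \<le> \<alpha> * a + (1 - \<alpha>) * b"
proof (cases "a = 0 \<or> b = 0")
  case True
  then show ?thesis using assms by auto
next
  case False
  then show ?thesis
    using assms by (intro Youngs_inequality_0) auto
qed

text \<open>After division by the total \<open>s\<close>, every share lies in [0, 1], where t \<le>
  t^q because q \<le> 1. The shares add up to 1.\<close>

lemma powr_sum_le:
  fixes x :: "'i \<Rightarrow> real"
  assumes "finite I" "\<And>i. i \<in> I \<Longrightarrow> 0 \<le> x i" "0 < q" "q \<le> 1"
  shows "(\<Sum>i\<in>I. x i) powr q \<le> (\<Sum>i\<in>I. x i powr q)"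
proof -
  define s where "s = (\<Sum>i\<in>I. x i)"
  have s0: "0 \<le> s" unfolding s_def using assms(2) by (rule sum_nonneg)
  show ?thesis
  proof (cases "s = 0")
    case True
    then show ?thesis using assms unfolding s_def by (auto intro: sum_nonneg)
  next
    case False
    with s0 have s: "0 < s" by simp
    have "x i / s \<le> x i powr q / s powr q" if i: "i \<in> I" for i
    proof (cases "x i = 0")
      case False
      with assms(2)[OF i] have x: "0 < x i" by simp
      have "x i \<le> s" unfolding s_def using assms i by (intro member_le_sum) auto
      then have "(x i / s) powr 1 \<le> (x i / s) powr q"
        using x s assms by (intro powr_mono') auto
      then show ?thesis using x s by (simp add: powr_divide)
    qed simp
    then have "(\<Sum>i\<in>I. x i / s) \<le> (\<Sum>i\<in>I. x i powr q / s powr q)" by (rule sum_mono)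
    then have "1 \<le> (\<Sum>i\<in>I. x i powr q) / s powr q"
      using s by (simp flip: sum_divide_distrib s_def)
    then show ?thesis using s by (simp add: s_def[symmetric] field_simps)
  qed
qed

text \<open>Convexity of t^q by its tangent at the mean \<open>m\<close>: Young's inequality with
  weight 1/q bounds x m^(q-1) for each summand x, and since the summands add up to c m, summation
  leaves c m^q \<le> sum of x^q.\<close>

lemma powr_sum_le_card:
  fixes x :: "'i \<Rightarrow> real"
  assumes "finite I" "I \<noteq> {}" "\<And>i. i \<in> I \<Longrightarrow> 0 \<le> x i" "1 \<le> q"
  shows "(\<Sum>i\<in>I. x i) powr q \<le> real (card I) powr (q - 1) * (\<Sum>i\<in>I. x i powr q)"
proof -
  define c where "c = real (card I)"
  define s where "s = (\<Sum>i\<in>I. x i)"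
  define m where "m = s / c"
  have c: "0 < c" using assms by (simp add: c_def card_gt_0_iff)
  have s0: "0 \<le> s" unfolding s_def using assms(3) by (rule sum_nonneg)
  then have m0: "0 \<le> m" using c by (simp add: m_def)
  have "x i * m powr (q - 1) \<le> 1 / q * x i powr q + (1 - 1 / q) * m powr q" if i: "i \<in> I" for i
    using weighted_arith_geo_mean[of "x i powr q" "m powr q" "1 / q"] assms(3)[OF i] m0 assms(4)
    by (simp add: powr_powr right_diff_distrib)
  then have "(\<Sum>i\<in>I. x i * m powr (q - 1)) \<le> (\<Sum>i\<in>I. 1 / q * x i powr q + (1 - 1 / q) * m powr q)"
    by (rule sum_mono)
  then have "s * m powr (q - 1) \<le> 1 / q * (\<Sum>i\<in>I. x i powr q) + c * ((1 - 1 / q) * m powr q)"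
    by (simp add: sum.distrib c_def s_def sum_divide_distrib flip: sum_distrib_right)
  moreover have "s * m powr (q - 1) = c * m powr q"
    using c s0 by (cases "s = 0") (auto simp: m_def powr_diff)
  ultimately have "c * m powr q * (1 / q) \<le> 1 / q * (\<Sum>i\<in>I. x i powr q)"
    by (simp add: algebra_simps)
  then have *: "c * m powr q \<le> (\<Sum>i\<in>I. x i powr q)"
    using assms(4) by (simp add: field_simps)
  have "s powr q = c powr (q - 1) * (c * m powr q)"
    using c s0 by (simp add: m_def powr_divide powr_diff)
  also have "\<dots> \<le> c powr (q - 1) * (\<Sum>i\<in>I. x i powr q)"
    using * c by (intro mult_left_mono) auto
  finally show ?thesis by (simp add: s_def c_def)
qed

section \<open>Extended powers and Jensen's inequality\<close>

lemma borel_measurable_epowr [measurable]: "(\<lambda>x. epowr x p) \<in> borel_measurable borel"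
  unfolding epowr_def by measurable

lemma epowr_ennreal: "0 \<le> x \<Longrightarrow> epowr (ennreal x) p = ennreal (x powr p)"
  by (simp add: epowr_def)

lemma epowr_cmult:
  assumes "0 < c"
  shows "epowr (ennreal c * x) p = ennreal (c powr p) * epowr x p"
proof (cases x)
  case (real r)
  then show ?thesis using assms
    by (simp add: ennreal_mult[symmetric] epowr_ennreal powr_mult)
next
  case top
  then show ?thesis using assms by (simp add: epowr_def ennreal_mult_top)
qed

text \<open>Jensen's inequality for the concave function t^(p/2) at f^2, again by a tangent line,
  now at the second moment \<open>A\<close>. An infinite \<open>A\<close> makes the bound trivial,
  and \<open>A = 0\<close> forces f = 0 almost everywhere.\<close>

lemma (in prob_space) nn_integral_powr_le:
  fixes f :: "'a \<Rightarrow> real"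
  assumes [measurable]: "f \<in> borel_measurable M" and p: "0 < p" "p \<le> 2"
  shows "(\<integral>\<^sup>+ x. ennreal (\<bar>f x\<bar> powr p) \<partial>M) \<le> epowr (\<integral>\<^sup>+ x. ennreal ((f x)\<^sup>2) \<partial>M) (p / 2)"
proof (cases "\<integral>\<^sup>+ x. ennreal ((f x)\<^sup>2) \<partial>M")
  case top
  then show ?thesis by (simp add: epowr_def)
next
  case (real A)
  show ?thesis
  proof (cases "A = 0")
    case True
    then have "AE x in M. f x = 0"
      using real by (simp add: nn_integral_0_iff_AE)
    then have "(\<integral>\<^sup>+ x. ennreal (\<bar>f x\<bar> powr p) \<partial>M) = (\<integral>\<^sup>+ x. 0 \<partial>M)"
      by (intro nn_integral_cong_AE) (auto simp: p)
    then show ?thesis by simp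
  next
    case False
    with real have A: "0 < A" by simp
    \<comment> \<open>Young's inequality bounds |f|^p c by a combination of f^2 and \<open>A\<close>
      whose integral is exactly \<open>A\<close>. As A = A^(p/2) c and c > 0, the factor
      \<open>c\<close> cancels in the end.\<close>
    define c where "c = A powr (1 - p / 2)"
    have c: "0 < c" using A by (simp add: c_def)
    have "\<bar>f x\<bar> powr p * c \<le> p / 2 * (f x)\<^sup>2 + (1 - p / 2) * A" for x
    proof -
      have "(f x)\<^sup>2 = \<bar>f x\<bar> powr 2" by simp
      then have "((f x)\<^sup>2) powr (p / 2) = \<bar>f x\<bar> powr p" by (simp only: powr_powr) simp
      then show ?thesis
        using weighted_arith_geo_mean[of "(f x)\<^sup>2" A "p / 2"] A p by (simp add: c_def)
    qed
    then have "(\<integral>\<^sup>+ x. ennreal (\<bar>f x\<bar> powr p) * ennreal c \<partial>M)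
        \<le> (\<integral>\<^sup>+ x. ennreal (p / 2) * ennreal ((f x)\<^sup>2) + ennreal ((1 - p / 2) * A) \<partial>M)"
      using c p A
      by (intro nn_integral_mono) (simp add: ennreal_mult[symmetric] ennreal_plus[symmetric] del: ennreal_plus)
    also have "\<dots> = ennreal (p / 2) * ennreal A + ennreal ((1 - p / 2) * A)"
      using real by (simp add: nn_integral_add nn_integral_cmult emeasure_space_1)
    also have "\<dots> = ennreal A"
      using A p by (simp add: ennreal_mult[symmetric] ennreal_plus[symmetric] algebra_simps del: ennreal_plus)
    also have "A = A powr (p / 2) * c"
      using A by (simp add: c_def flip: powr_add)
    finally have "(\<integral>\<^sup>+ x. ennreal (\<bar>f x\<bar> powr p) \<partial>M) * ennreal c \<le> ennreal (A powr (p / 2)) * ennreal c"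
      using c A by (simp add: nn_integral_multc ennreal_mult)
    then have "(\<integral>\<^sup>+ x. ennreal (\<bar>f x\<bar> powr p) \<partial>M) \<le> ennreal (A powr (p / 2))"
      using c by (subst (asm) (1 2) mult.commute) (simp add: ennreal_mult_le_mult_iff)
    then show ?thesis using real A by (simp add: epowr_ennreal)
  qed
qed

text \<open>Expanding the square, each off-diagonal product has a coordinate factor of mean zero, so
  its integral vanishes and only the diagonal remains.\<close>

lemma (in prob_space) nn_integral_PiM_sum_square:
  fixes I :: "'i set" and d :: "'a \<Rightarrow> real"
  assumes I: "finite I" and d [measurable]: "d \<in> borel_measurable M"
    and sq: "integrable M (\<lambda>x. (d x)\<^sup>2)" and mean: "(\<integral>x. d x \<partial>M) = 0"
  shows "(\<integral>\<^sup>+ x. ennreal ((\<Sum>i\<in>I. d (x i))\<^sup>2) \<partial>PiM I (\<lambda>_. M))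
    = ennreal (real (card I)) * (\<integral>\<^sup>+ x. ennreal ((d x)\<^sup>2) \<partial>M)"
proof -
  have int: "integrable M d"
    using square_integrable_imp_integrable[OF d sq] .
  interpret PM: product_prob_space "\<lambda>_. M" I by unfold_locales
  \<comment> \<open>\<open>d(x\<^sub>i) d(x\<^sub>j)\<close> as a product over all coordinates \<open>l\<close>, so that its integral factorizes\<close>
  define f where "f = (\<lambda>i j (l :: 'i) x. (if l = i then d x else 1) * (if l = j then d x else 1))"
  have fint: "integrable M (f i j l)" for i j l
    using int sq by (cases "l = i"; cases "l = j") (auto simp: f_def power2_eq_square)
  have prod: "(\<Prod>l\<in>I. f i j l (x l)) = d (x i) * d (x j)" if "i \<in> I" "j \<in> I" for i j and x :: "'i \<Rightarrow> 'a"
    using that I by (simp add: f_def prod.distrib prod.delta)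
  have val: "(\<Prod>l\<in>I. (\<integral>x. f i j l x \<partial>M)) = (if i = j then (\<integral>x. (d x)\<^sup>2 \<partial>M) else 0)"
    if "i \<in> I" "j \<in> I" for i j
  proof (cases "i = j")
    case True
    have "(\<Prod>l\<in>I. (\<integral>x. f i i l x \<partial>M)) = (\<Prod>l\<in>I. if l = i then (\<integral>x. (d x)\<^sup>2 \<partial>M) else 1)"
      by (intro prod.cong) (auto simp: f_def power2_eq_square prob_space)
    then show ?thesis using True that I by simp
  next
    case False
    have "(\<integral>x. f i j i x \<partial>M) = 0"
      using False mean by (simp add: f_def)
    then show ?thesis using False that I by (auto simp: prod_zero_iff)
  qed
  have int2: "integrable (PiM I (\<lambda>_. M)) (\<lambda>x. d (x i) * d (x j))" if "i \<in> I" "j \<in> I" for i j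
    using PM.product_integrable_prod[OF I, of "f i j"] fint prod[OF that] by simp
  have eq2: "(\<integral>x. d (x i) * d (x j) \<partial>PiM I (\<lambda>_. M)) = (if i = j then (\<integral>x. (d x)\<^sup>2 \<partial>M) else 0)"
    if "i \<in> I" "j \<in> I" for i j
    using PM.product_integral_prod[OF I, of "f i j"] fint prod[OF that] val[OF that] by simp
  have ex: "(\<Sum>i\<in>I. d (x i))\<^sup>2 = (\<Sum>i\<in>I. \<Sum>j\<in>I. d (x i) * d (x j))" for x
    by (simp add: power2_eq_square sum_product)
  have "(\<integral>x. (\<Sum>i\<in>I. d (x i))\<^sup>2 \<partial>PiM I (\<lambda>_. M)) = (\<Sum>i\<in>I. \<Sum>j\<in>I. if i = j then (\<integral>x. (d x)\<^sup>2 \<partial>M) else 0)"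
    unfolding ex using int2 by (simp add: integral_sum integrable_sum eq2)
  also have "\<dots> = real (card I) * (\<integral>x. (d x)\<^sup>2 \<partial>M)"
    using I by simp
  finally have *: "(\<integral>x. (\<Sum>i\<in>I. d (x i))\<^sup>2 \<partial>PiM I (\<lambda>_. M)) = real (card I) * (\<integral>x. (d x)\<^sup>2 \<partial>M)" .
  have "(\<integral>\<^sup>+ x. ennreal ((\<Sum>i\<in>I. d (x i))\<^sup>2) \<partial>PiM I (\<lambda>_. M))
      = ennreal (\<integral>x. (\<Sum>i\<in>I. d (x i))\<^sup>2 \<partial>PiM I (\<lambda>_. M))"
  proof (rule nn_integral_eq_integral)
    show "integrable (PiM I (\<lambda>_. M)) (\<lambda>x. (\<Sum>i\<in>I. d (x i))\<^sup>2)"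
      unfolding ex using int2 by (intro Bochner_Integration.integrable_sum)
  qed simp
  also have "\<dots> = ennreal (real (card I)) * ennreal (\<integral>x. (d x)\<^sup>2 \<partial>M)"
    by (simp add: * ennreal_mult)
  also have "ennreal (\<integral>x. (d x)\<^sup>2 \<partial>M) = (\<integral>\<^sup>+ x. ennreal ((d x)\<^sup>2) \<partial>M)"
    using sq by (intro nn_integral_eq_integral[symmetric]) auto
  finally show ?thesis .
qed

subsection \<open>Conditional expectations under independence\<close>

text \<open>With the training data frozen at \<open>v\<close>, this is the deviation from the
  conditional mean. The Bochner integral is 0 for a non-integrable slice, so the mean of the result
  is known to vanish only where the slice is integrable.\<close>

definition centered :: "'z measure \<Rightarrow> ('z \<Rightarrow> 'v \<Rightarrow> real) \<Rightarrow> 'z \<Rightarrow> 'v \<Rightarrow> real" where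
  "centered P f z v = f z v - (\<integral>y. f y v \<partial>P)"

definition slice_var :: "'z measure \<Rightarrow> ('z \<Rightarrow> 'v \<Rightarrow> real) \<Rightarrow> 'v \<Rightarrow> ennreal" where
  "slice_var P f v = (\<integral>\<^sup>+ z. ennreal ((centered P f z v)\<^sup>2) \<partial>P)"

lemma (in prob_space) measurable_centered:
  assumes [measurable]: "case_prod f \<in> borel_measurable (M \<Otimes>\<^sub>M K)"
  shows "case_prod (centered M f) \<in> borel_measurable (M \<Otimes>\<^sub>M K)"
  unfolding centered_def by measurable

lemma (in prob_space) measurable_slice_var:
  assumes "case_prod f \<in> borel_measurable (M \<Otimes>\<^sub>M K)"
  shows "slice_var M f \<in> borel_measurable K"
proof -
  note [measurable] = measurable_centered[OF assms]
  show ?thesis unfolding slice_var_def by measurable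
qed

lemma (in prob_space) subalgebra_vimage:
  assumes "Y \<in> measurable M K"
  shows "finite_measure_subalgebra M (vimage_algebra (space M) Y K)"
proof
  show "subalgebra M (vimage_algebra (space M) Y K)"
    unfolding subalgebra_def
    using assms by (auto simp: sets_vimage_algebra2 measurable_space)
qed

text \<open>Independence in the form of a product law. \<open>P\<close> is both the target space and
  the law of \<open>X\<close>, so averaging over a fresh \<open>X\<close> is integration over
  \<open>P\<close>; \<open>X\<close> may be one point or a whole validation block.\<close>

locale indep_pair = prob_space M for M :: "'a measure" +
  fixes P :: "'z measure" and K :: "'v measure" and X :: "'a \<Rightarrow> 'z" and Y :: "'a \<Rightarrow> 'v"
  assumes X: "X \<in> measurable M P" and Y: "Y \<in> measurable M K"
    and distr_X: "distr M P X = P"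
    and distr_pair: "distr M (P \<Otimes>\<^sub>M K) (\<lambda>\<omega>. (X \<omega>, Y \<omega>)) = P \<Otimes>\<^sub>M distr M K Y"
begin

sublocale P: prob_space P
  using prob_space_distr[OF X] by (simp add: distr_X)

text \<open>Tonelli's theorem under the product law, with the outer integral pulled back along
  \<open>Y\<close>.\<close>

lemma nn_integral_pair:
  assumes f [measurable]: "case_prod f \<in> borel_measurable (P \<Otimes>\<^sub>M K)"
  shows "(\<integral>\<^sup>+ \<omega>. f (X \<omega>) (Y \<omega>) \<partial>M) = (\<integral>\<^sup>+ \<omega>. (\<integral>\<^sup>+ z. f z (Y \<omega>) \<partial>P) \<partial>M)"
proof -
  note [measurable] = X Y
  interpret Q: prob_space "distr M K Y" by (rule prob_space_distr) (rule Y)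
  interpret PQ: pair_sigma_finite P "distr M K Y" by unfold_locales
  have "(\<integral>\<^sup>+ \<omega>. f (X \<omega>) (Y \<omega>) \<partial>M) = (\<integral>\<^sup>+ x. case_prod f x \<partial>distr M (P \<Otimes>\<^sub>M K) (\<lambda>\<omega>. (X \<omega>, Y \<omega>)))"
    by (subst nn_integral_distr) auto
  also have "\<dots> = (\<integral>\<^sup>+ v. (\<integral>\<^sup>+ z. f z v \<partial>P) \<partial>distr M K Y)"
    unfolding distr_pair by (subst PQ.nn_integral_snd[symmetric]) auto
  also have "\<dots> = (\<integral>\<^sup>+ \<omega>. (\<integral>\<^sup>+ z. f z (Y \<omega>) \<partial>P) \<partial>M)"
    by (subst nn_integral_distr) auto
  finally show ?thesis .
qed

abbreviation "\<F> \<equiv> vimage_algebra (space M) Y K"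

text \<open>Freezing lemma: given \<open>Y\<close>, the independent \<open>X\<close> is integrated
  out. Every event of \<open>\<F>\<close> has the form Y in C, so its indicator is a function of
  \<open>Y\<close> and can be absorbed into the integrand of the preceding Tonelli formula.\<close>

lemma nn_cond_exp_pair:
  assumes f [measurable]: "case_prod f \<in> borel_measurable (P \<Otimes>\<^sub>M K)"
  shows "AE \<omega> in M. nn_cond_exp M \<F> (\<lambda>\<omega>. f (X \<omega>) (Y \<omega>)) \<omega> = (\<integral>\<^sup>+ z. f z (Y \<omega>) \<partial>P)"
proof -
  note [measurable] = X Y
  interpret F: finite_measure_subalgebra M \<F> by (rule subalgebra_vimage[OF Y])
  have YF [measurable]: "Y \<in> measurable \<F> K"
    by (intro measurable_vimage_algebra1) (auto intro: measurable_space[OF Y])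
  have "(\<integral>\<^sup>+ \<omega> \<in> A. f (X \<omega>) (Y \<omega>) \<partial>M) = (\<integral>\<^sup>+ \<omega> \<in> A. (\<integral>\<^sup>+ z. f z (Y \<omega>) \<partial>P) \<partial>M)"
    if A: "A \<in> sets \<F>" for A
  proof -
    obtain C where [measurable]: "C \<in> sets K" and C: "A = Y -` C \<inter> space M"
      using A Y by (auto simp: sets_vimage_algebra2 measurable_space)
    have "(\<integral>\<^sup>+ \<omega> \<in> A. f (X \<omega>) (Y \<omega>) \<partial>M) = (\<integral>\<^sup>+ \<omega>. f (X \<omega>) (Y \<omega>) * indicator C (Y \<omega>) \<partial>M)"
      by (intro nn_integral_cong) (auto simp: C indicator_def)
    also have "\<dots> = (\<integral>\<^sup>+ \<omega>. (\<integral>\<^sup>+ z. f z (Y \<omega>) * indicator C (Y \<omega>) \<partial>P) \<partial>M)"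
      by (rule nn_integral_pair[where f = "\<lambda>z v. f z v * indicator C v"]) measurable
    also have "\<dots> = (\<integral>\<^sup>+ \<omega> \<in> A. (\<integral>\<^sup>+ z. f z (Y \<omega>) \<partial>P) \<partial>M)"
      by (intro nn_integral_cong) (auto simp: C indicator_def)
    finally show ?thesis .
  qed
  from F.nn_cond_exp_charact[OF this] show ?thesis by force
qed

text \<open>Positive and negative parts are frozen separately, and integrability of the slice makes
  their difference the Bochner integral. Integrability is asked of slices only, in keeping with a
  purely conditional first moment.\<close>

lemma real_cond_exp_pair:
  fixes f :: "'z \<Rightarrow> 'v \<Rightarrow> real"
  assumes f [measurable]: "case_prod f \<in> borel_measurable (P \<Otimes>\<^sub>M K)"
    and int: "AE \<omega> in M. integrable P (\<lambda>z. f z (Y \<omega>))"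
  shows "AE \<omega> in M. real_cond_exp M \<F> (\<lambda>\<omega>. f (X \<omega>) (Y \<omega>)) \<omega> = (\<integral>z. f z (Y \<omega>) \<partial>P)"
proof -
  have "AE \<omega> in M. nn_cond_exp M \<F> (\<lambda>\<omega>. ennreal (f (X \<omega>) (Y \<omega>))) \<omega> = (\<integral>\<^sup>+ z. ennreal (f z (Y \<omega>)) \<partial>P)"
    by (rule nn_cond_exp_pair[where f = "\<lambda>z v. ennreal (f z v)"]) measurable
  moreover have "AE \<omega> in M. nn_cond_exp M \<F> (\<lambda>\<omega>. ennreal (- f (X \<omega>) (Y \<omega>))) \<omega> = (\<integral>\<^sup>+ z. ennreal (- f z (Y \<omega>)) \<partial>P)"
    by (rule nn_cond_exp_pair[where f = "\<lambda>z v. ennreal (- f z v)"]) measurable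
  ultimately show ?thesis
    using int by eventually_elim (simp add: real_cond_exp_def real_lebesgue_integral_def)
qed

text \<open>The conditional mean inside the square may be replaced by the slice mean up to a null
  set; the freezing lemma then applies to the squared deviation.\<close>

lemma cond_var_pair:
  fixes f :: "'z \<Rightarrow> 'v \<Rightarrow> real"
  assumes f [measurable]: "case_prod f \<in> borel_measurable (P \<Otimes>\<^sub>M K)"
    and int: "AE \<omega> in M. integrable P (\<lambda>z. f z (Y \<omega>))"
  shows "AE \<omega> in M. cond_var M \<F> (\<lambda>\<omega>. f (X \<omega>) (Y \<omega>)) \<omega> = slice_var P f (Y \<omega>)"
proof -
  note [measurable] = X Y P.measurable_centered[OF f]
  interpret F: finite_measure_subalgebra M \<F> by (rule subalgebra_vimage[OF Y])
  have "AE \<omega> in M. cond_var M \<F> (\<lambda>\<omega>. f (X \<omega>) (Y \<omega>)) \<omega>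
      = nn_cond_exp M \<F> (\<lambda>\<omega>. ennreal ((centered P f (X \<omega>) (Y \<omega>))\<^sup>2)) \<omega>"
    unfolding cond_var_def
  proof (rule F.nn_cond_exp_cong)
    show "AE \<omega> in M. ennreal ((f (X \<omega>) (Y \<omega>) - real_cond_exp M \<F> (\<lambda>\<omega>. f (X \<omega>) (Y \<omega>)) \<omega>)\<^sup>2)
        = ennreal ((centered P f (X \<omega>) (Y \<omega>))\<^sup>2)"
      using real_cond_exp_pair[OF f int] by eventually_elim (simp add: centered_def)
  qed measurable
  moreover have "AE \<omega> in M. nn_cond_exp M \<F> (\<lambda>\<omega>. ennreal ((centered P f (X \<omega>) (Y \<omega>))\<^sup>2)) \<omega>
      = slice_var P f (Y \<omega>)"
    unfolding slice_var_def
    by (rule nn_cond_exp_pair[where f = "\<lambda>z v. ennreal ((centered P f z v)\<^sup>2)"]) measurable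
  ultimately show ?thesis by eventually_elim simp
qed

end

subsection \<open>Independent samples and fold moments\<close>

locale iid_sample = prob_space M for M :: "'a measure" +
  fixes N :: "'z measure" and Z :: "nat \<Rightarrow> 'a \<Rightarrow> 'z"
  assumes indep: "indep_vars (\<lambda>_. N) Z UNIV"
    and ident: "distr M N (Z i) = distr M N (Z 0)"
begin

definition P :: "'z measure" where "P = distr M N (Z 0)"

lemma measurable_Z [measurable]: "Z i \<in> measurable M N"
  using indep by (auto simp: indep_vars_def)

lemma sets_P [measurable_cong, simp]: "sets P = sets N" by (simp add: P_def)

lemma distr_N_Z: "distr M N (Z i) = P"
  unfolding P_def by (rule ident)

lemma distr_Z: "distr M P (Z i) = P"
proof -
  have "distr M P (Z i) = distr M N (Z i)" by (rule distr_cong) auto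
  then show ?thesis by (simp add: distr_N_Z)
qed

sublocale P: prob_space P
  unfolding P_def by (rule prob_space_distr) measurable

lemma measurable_subvec [measurable]:
  assumes "m = length bs"
  shows "subvec Z bs \<in> measurable M (vec_space N m)"
  unfolding subvec_def vec_space_def assms by measurable

lemma distr_restrict_Z:
  assumes "J \<noteq> {}"
  shows "distr M (PiM J (\<lambda>_. N)) (\<lambda>\<omega>. \<lambda>i\<in>J. Z i \<omega>) = PiM J (\<lambda>_. P)"
proof -
  have "indep_vars (\<lambda>_. N) Z J" by (rule indep_vars_subset[OF indep]) simp
  then show ?thesis
    using indep_vars_iff_distr_eq_PiM'[OF assms, where M' = "\<lambda>_. N" and X = Z] by (simp add: distr_N_Z)
qed

text \<open>Reading off distinct indices is an injective reindexing of a product measure, so the law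
  of the subvector depends on its length alone. This makes all training vectors
  interchangeable.\<close>

lemma distr_subvec:
  assumes bs: "distinct bs" "bs \<noteq> []"
  shows "distr M (vec_space N (length bs)) (subvec Z bs) = PiM {..<length bs} (\<lambda>_. P)"
proof -
  let ?J = "set bs" and ?I = "{..<length bs}"
  have nth: "(\<lambda>i. bs ! i) \<in> ?I \<rightarrow> ?J" by auto
  have t: "(\<lambda>x. \<lambda>i\<in>?I. x (bs ! i)) \<in> measurable (PiM ?J (\<lambda>_. N)) (PiM ?I (\<lambda>_. P))"
    unfolding measurable_cong_sets[OF refl sets_PiM_cong[OF refl sets_P]]
    by (intro measurable_restrict measurable_component_singleton) auto
  have "PiM ?I (\<lambda>_. P) = distr (PiM ?J (\<lambda>_. P)) (PiM ?I (\<lambda>_. P)) (\<lambda>x. \<lambda>i\<in>?I. x (bs ! i))"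
    using bs nth
    by (intro distr_PiM_reindex[symmetric]) (auto intro: P.prob_space_axioms simp: inj_on_def nth_eq_iff_index_eq)
  also have "\<dots> = distr M (PiM ?I (\<lambda>_. P)) ((\<lambda>x. \<lambda>i\<in>?I. x (bs ! i)) \<circ> (\<lambda>\<omega>. \<lambda>i\<in>?J. Z i \<omega>))"
    using bs by (subst distr_restrict_Z[symmetric]) (auto intro!: distr_distr t)
  also have "\<dots> = distr M (vec_space N (length bs)) (subvec Z bs)"
    by (rule distr_cong) (auto simp: vec_space_def subvec_def fun_eq_iff restrict_def intro!: sets_PiM_cong)
  finally show ?thesis by simp
qed

text \<open>Restrictions of \<open>Z\<close> to disjoint index sets are independent, and
  \<open>subvec Z bs\<close> is a measurable function of the restriction to
  \<open>set bs\<close>.\<close>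

lemma indep_pair_block:
  assumes I: "I \<noteq> {}" "I \<inter> set bs = {}"
  shows "indep_pair M (PiM I (\<lambda>_. P)) (vec_space N (length bs)) (\<lambda>\<omega>. \<lambda>i\<in>I. Z i \<omega>) (subvec Z bs)"
proof
  let ?J = "set bs" and ?K = "vec_space N (length bs)"
  \<comment> \<open>\<open>N\<close> and \<open>P\<close> share their measurable sets, so laws
    computed over \<open>N\<close> can be restated over \<open>P\<close>.\<close>
  have sets: "sets (PiM I (\<lambda>_. P)) = sets (PiM I (\<lambda>_. N))" by (rule sets_PiM_cong) auto
  show "(\<lambda>\<omega>. \<lambda>i\<in>I. Z i \<omega>) \<in> measurable M (PiM I (\<lambda>_. P))" by measurable
  show "subvec Z bs \<in> measurable M ?K" by measurable
  have "distr M (PiM I (\<lambda>_. P)) (\<lambda>\<omega>. \<lambda>i\<in>I. Z i \<omega>) = distr M (PiM I (\<lambda>_. N)) (\<lambda>\<omega>. \<lambda>i\<in>I. Z i \<omega>)"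
    by (rule distr_cong) (auto simp: sets)
  then show 1: "distr M (PiM I (\<lambda>_. P)) (\<lambda>\<omega>. \<lambda>i\<in>I. Z i \<omega>) = PiM I (\<lambda>_. P)"
    using distr_restrict_Z[OF I(1)] by simp
  let ?t = "\<lambda>x. \<lambda>i\<in>{..<length bs}. x (bs ! i)"
  have t: "?t \<in> measurable (PiM ?J (\<lambda>_. N)) ?K"
    unfolding vec_space_def by (intro measurable_restrict measurable_component_singleton) auto
  have "indep_var (PiM I (\<lambda>_. N)) (\<lambda>\<omega>. \<lambda>i\<in>I. Z i \<omega>) (PiM ?J (\<lambda>_. N)) (\<lambda>\<omega>. \<lambda>i\<in>?J. Z i \<omega>)"
    by (rule indep_var_restrict[OF indep]) (use I in auto)
  from indep_var_compose[OF this measurable_id t]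
  have "indep_var (PiM I (\<lambda>_. N)) (\<lambda>\<omega>. \<lambda>i\<in>I. Z i \<omega>) ?K (?t \<circ> (\<lambda>\<omega>. \<lambda>i\<in>?J. Z i \<omega>))"
    by (simp add: comp_def)
  also have "?t \<circ> (\<lambda>\<omega>. \<lambda>i\<in>?J. Z i \<omega>) = subvec Z bs"
    by (auto simp: subvec_def fun_eq_iff restrict_def)
  finally have "distr M (PiM I (\<lambda>_. N)) (\<lambda>\<omega>. \<lambda>i\<in>I. Z i \<omega>) \<Otimes>\<^sub>M distr M ?K (subvec Z bs)
      = distr M (PiM I (\<lambda>_. N) \<Otimes>\<^sub>M ?K) (\<lambda>\<omega>. (\<lambda>i\<in>I. Z i \<omega>, subvec Z bs \<omega>))"
    unfolding indep_var_distribution_eq by blast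
  also have "\<dots> = distr M (PiM I (\<lambda>_. P) \<Otimes>\<^sub>M ?K) (\<lambda>\<omega>. (\<lambda>i\<in>I. Z i \<omega>, subvec Z bs \<omega>))"
    by (rule distr_cong) (auto intro!: sets_pair_measure_cong simp: sets)
  finally show "distr M (PiM I (\<lambda>_. P) \<Otimes>\<^sub>M ?K) (\<lambda>\<omega>. (\<lambda>i\<in>I. Z i \<omega>, subvec Z bs \<omega>))
      = PiM I (\<lambda>_. P) \<Otimes>\<^sub>M distr M ?K (subvec Z bs)"
    by (simp add: distr_restrict_Z[OF I(1)])
qed

text \<open>The one-element block, transported along evaluation at \<open>i\<close>.\<close>

lemma indep_pair_single:
  assumes i: "i \<notin> set bs"
  shows "indep_pair M P (vec_space N (length bs)) (Z i) (subvec Z bs)"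
proof
  let ?K = "vec_space N (length bs)"
  show Zi [measurable]: "Z i \<in> measurable M P" by measurable
  show sub [measurable]: "subvec Z bs \<in> measurable M ?K" by measurable
  show "distr M P (Z i) = P" by (rule distr_Z)
  interpret I: indep_pair M "PiM {i} (\<lambda>_. P)" ?K "\<lambda>\<omega>. \<lambda>i\<in>{i}. Z i \<omega>" "subvec Z bs"
    using i by (intro indep_pair_block) auto
  interpret Q: prob_space "distr M ?K (subvec Z bs)" by (rule prob_space_distr) measurable
  interpret PP: product_prob_space "\<lambda>_. P" "{i}" by unfold_locales
  have c: "distr (PiM {i} (\<lambda>_. P)) P (\<lambda>x. x i) = P" by (rule PP.PiM_component) simp
  \<comment> \<open>The second factor is written as an image under the identity, so that the pair of
    maps (evaluation, identity) acts on the product measure.\<close>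
  have id: "distr (distr M ?K (subvec Z bs)) ?K (\<lambda>v. v) = distr M ?K (subvec Z bs)"
    by (rule distr_id2) simp
  have "P \<Otimes>\<^sub>M distr M ?K (subvec Z bs)
      = distr (PiM {i} (\<lambda>_. P)) P (\<lambda>x. x i) \<Otimes>\<^sub>M distr (distr M ?K (subvec Z bs)) ?K (\<lambda>v. v)"
    by (simp only: c id)
  also have "\<dots> = distr (PiM {i} (\<lambda>_. P) \<Otimes>\<^sub>M distr M ?K (subvec Z bs)) (P \<Otimes>\<^sub>M ?K) (\<lambda>(x, v). (x i, v))"
    by (rule pair_measure_distr) (auto simp: id Q.sigma_finite_measure_axioms)
  also have "\<dots> = distr M (P \<Otimes>\<^sub>M ?K) (\<lambda>\<omega>. (Z i \<omega>, subvec Z bs \<omega>))"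
    unfolding I.distr_pair[symmetric]
    by (subst distr_distr) (auto simp: comp_def)
  finally show "distr M (P \<Otimes>\<^sub>M ?K) (\<lambda>\<omega>. (Z i \<omega>, subvec Z bs \<omega>)) = P \<Otimes>\<^sub>M distr M ?K (subvec Z bs)"
    by simp
qed

text \<open>With the training vector frozen, Jensen's inequality reduces order \<open>p\<close> to
  order 2, where the i.i.d. centered summands contribute \<open>card I\<close> variances. The weight
  \<open>c\<close> depends on the training data only and passes through; it later carries a
  truncation.\<close>

lemma fold_moment_le:
  fixes f :: "'z \<Rightarrow> (nat \<Rightarrow> 'z) \<Rightarrow> real" and c :: "(nat \<Rightarrow> 'z) \<Rightarrow> ennreal"
  assumes I: "finite I" "I \<noteq> {}" "I \<inter> set bs = {}" and m: "length bs = m"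
    and f: "case_prod f \<in> borel_measurable (P \<Otimes>\<^sub>M vec_space N m)"
    and c [measurable]: "c \<in> borel_measurable (vec_space N m)"
    and int: "AE \<omega> in M. integrable P (\<lambda>z. f z (subvec Z bs \<omega>))"
    and p: "0 < p" "p \<le> 2"
  shows "(\<integral>\<^sup>+ \<omega>. ennreal (\<bar>\<Sum>i\<in>I. centered P f (Z i \<omega>) (subvec Z bs \<omega>)\<bar> powr p) * c (subvec Z bs \<omega>) \<partial>M)
    \<le> (\<integral>\<^sup>+ \<omega>. epowr (ennreal (real (card I)) * slice_var P f (subvec Z bs \<omega>)) (p / 2) * c (subvec Z bs \<omega>) \<partial>M)"
proof -
  let ?K = "vec_space N m"
  note cent [measurable] = P.measurable_centered[OF f]
  interpret I: indep_pair M "PiM I (\<lambda>_. P)" ?K "\<lambda>\<omega>. \<lambda>i\<in>I. Z i \<omega>" "subvec Z bs"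
    using indep_pair_block[OF I(2,3)] by (simp add: m)
  let ?g = "\<lambda>x v. ennreal (\<bar>\<Sum>i\<in>I. centered P f (x i) v\<bar> powr p) * c v"
  have comp: "(\<lambda>(x, v). centered P f (x i) v) \<in> borel_measurable (PiM I (\<lambda>_. P) \<Otimes>\<^sub>M ?K)" if "i \<in> I" for i
  proof -
    have [measurable]: "(\<lambda>x. x i) \<in> measurable (PiM I (\<lambda>_. P)) P"
      using that by (rule measurable_component_singleton)
    show ?thesis by measurable
  qed
  have g: "case_prod ?g \<in> borel_measurable (PiM I (\<lambda>_. P) \<Otimes>\<^sub>M ?K)"
  proof -
    have [measurable]: "(\<lambda>y. \<Sum>i\<in>I. centered P f (fst y i) (snd y)) \<in> borel_measurable (PiM I (\<lambda>_. P) \<Otimes>\<^sub>M ?K)"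
      using comp by (intro borel_measurable_sum) (auto simp: case_prod_beta)
    show ?thesis by (simp add: case_prod_beta)
  qed
  have "(\<integral>\<^sup>+ \<omega>. ennreal (\<bar>\<Sum>i\<in>I. centered P f (Z i \<omega>) (subvec Z bs \<omega>)\<bar> powr p) * c (subvec Z bs \<omega>) \<partial>M)
      = (\<integral>\<^sup>+ \<omega>. ?g (\<lambda>i\<in>I. Z i \<omega>) (subvec Z bs \<omega>) \<partial>M)"
    by (intro nn_integral_cong) simp
  also have "\<dots> = (\<integral>\<^sup>+ \<omega>. (\<integral>\<^sup>+ x. ?g x (subvec Z bs \<omega>) \<partial>PiM I (\<lambda>_. P)) \<partial>M)"
    by (rule I.nn_integral_pair) (rule g)
  also have "\<dots> \<le> (\<integral>\<^sup>+ \<omega>. epowr (ennreal (real (card I)) * slice_var P f (subvec Z bs \<omega>)) (p / 2) * c (subvec Z bs \<omega>) \<partial>M)"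
  proof (rule nn_integral_mono_AE)
    show "AE \<omega> in M. (\<integral>\<^sup>+ x. ?g x (subvec Z bs \<omega>) \<partial>PiM I (\<lambda>_. P))
      \<le> epowr (ennreal (real (card I)) * slice_var P f (subvec Z bs \<omega>)) (p / 2) * c (subvec Z bs \<omega>)"
      using int AE_space
    proof eventually_elim
      fix \<omega> assume int: "integrable P (\<lambda>z. f z (subvec Z bs \<omega>))" and \<omega>: "\<omega> \<in> space M"
      define v where "v = subvec Z bs \<omega>"
      have v: "v \<in> space ?K" unfolding v_def by (rule measurable_space[OF measurable_subvec[OF m[symmetric]] \<omega>])
      have d [measurable]: "(\<lambda>z. centered P f z v) \<in> borel_measurable P"
        using v by measurable
      have S [measurable]: "(\<lambda>x. \<Sum>i\<in>I. centered P f (x i) v) \<in> borel_measurable (PiM I (\<lambda>_. P))"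
        by measurable
      have "(\<integral>\<^sup>+ x. ennreal (\<bar>\<Sum>i\<in>I. centered P f (x i) v\<bar> powr p) \<partial>PiM I (\<lambda>_. P))
        \<le> epowr (ennreal (real (card I)) * slice_var P f v) (p / 2)"
      proof (cases "slice_var P f v = \<infinity>")
        \<comment> \<open>Since \<open>I\<close> is nonempty, the factor \<open>card I\<close> is
          positive and the right side is infinite; this disposes of slices without a second
          moment.\<close>
        case True
        then show ?thesis using I by (simp add: epowr_def ennreal_mult_top card_gt_0_iff)
      next
        case False
        have mean: "(\<integral>z. centered P f z v \<partial>P) = 0"
          using int by (simp add: centered_def v_def P.prob_space)
        have sq: "integrable P (\<lambda>z. (centered P f z v)\<^sup>2)"
          using False by (intro integrableI_bounded) (auto simp: slice_var_def less_top)
        show ?thesis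
          using I.P.nn_integral_powr_le[OF S p] P.nn_integral_PiM_sum_square[OF I(1) d sq mean]
          by (simp add: slice_var_def)
      qed
      then show "(\<integral>\<^sup>+ x. ?g x (subvec Z bs \<omega>) \<partial>PiM I (\<lambda>_. P))
        \<le> epowr (ennreal (real (card I)) * slice_var P f (subvec Z bs \<omega>)) (p / 2) * c (subvec Z bs \<omega>)"
        by (fold v_def) (subst nn_integral_multc, auto intro!: mult_right_mono)
    qed
  qed
  finally show ?thesis .
qed

end

subsection \<open>Bounds for the cross-validation statistic\<close>

text \<open>A single sample size is fixed, so the bounds below are nonasymptotic. \<open>Y0\<close>
  is the reference training vector on the indices 1 to \<open>m\<close>.\<close>

locale cv_setting = iid_sample M N Z
  for M :: "'a measure" and N :: "'z measure" and Z :: "nat \<Rightarrow> 'a \<Rightarrow> 'z" +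
  fixes n k :: nat and B B' :: "nat \<Rightarrow> nat list"
    and h :: "'z \<Rightarrow> (nat \<Rightarrow> 'z) \<Rightarrow> real" and g :: "'z \<Rightarrow> real" and \<sigma> :: real
    and m :: nat and Y0 :: "'a \<Rightarrow> nat \<Rightarrow> 'z"
  defines "m \<equiv> train_len n k" and "Y0 \<equiv> subvec Z [1..<Suc m]"
  assumes n_pos: "0 < n" and k_ge: "2 \<le> k" and k_dvd: "k dvd n"
    and splits: "cv_splits n k B B'"
    and h_meas [measurable]: "case_prod h \<in> borel_measurable (N \<Otimes>\<^sub>M vec_space N m)"
    and h_cond_exp: "AE \<omega> in M. nn_cond_exp M (sigma_subvec M N Z [1..<Suc m])
             (\<lambda>\<omega>'. ennreal \<bar>h (Z 0 \<omega>') (Y0 \<omega>')\<bar>) \<omega> < \<infinity>"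
    and g_meas [measurable]: "g \<in> borel_measurable N"
    and g_sq: "integrable M (\<lambda>\<omega>. (g (Z 0 \<omega>))\<^sup>2)"
    and \<sigma>_pos: "0 < \<sigma>"
begin

text \<open>As \<open>g\<close> ignores the training data, centering this difference subtracts the
  conditional mean of \<open>h\<close> and the mean of \<open>g\<close> at once.\<close>

definition f :: "'z \<Rightarrow> (nat \<Rightarrow> 'z) \<Rightarrow> real" where
  "f z v = h z v - g z"

definition fold_sum :: "nat \<Rightarrow> 'a \<Rightarrow> real" where
  "fold_sum j \<omega> = (\<Sum>i\<in>set (B' j). centered P f (Z i \<omega>) (subvec Z (B j) \<omega>))"

abbreviation "T \<equiv> cv_stat M N Z n k B B' h g \<sigma>"
abbreviation "V \<equiv> var_Z0 M N Z m h g"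
abbreviation "K \<equiv> vec_space N m"

section \<open>Sizes of folds and training vectors\<close>

lemma train_len_pos: "0 < m"
  using n_pos k_ge by (simp add: m_def train_len_def)

lemma fold_size: "real (n div k) = real n / real k" "0 < n div k"
  using k_dvd n_pos k_ge by (auto simp: real_of_nat_div dvd_imp_le div_greater_zero_iff)

lemma
  assumes "j \<in> {1..k}"
  shows distinct_B: "distinct (B j)" and length_B: "length (B j) = m"
    and card_B': "card (set (B' j)) = n div k" and B'_B: "set (B' j) \<inter> set (B j) = {}"
    and B'_ne: "set (B' j) \<noteq> {}"
proof -
  have j: "distinct (B j)" "distinct (B' j)" "set (B j) \<inter> set (B' j) = {}"
    "set (B j) \<union> set (B' j) = {1..n}" "length (B' j) = n div k"
    using splits assms unfolding cv_splits_def by blast+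
  show "distinct (B j)" "set (B' j) \<inter> set (B j) = {}" using j by auto
  show c: "card (set (B' j)) = n div k" using j distinct_card by metis
  have "card (set (B j)) + card (set (B' j)) = n"
    using j card_Un_disjoint[of "set (B j)" "set (B' j)"] by simp
  then show "length (B j) = m"
    using c j distinct_card[of "B j"] by (simp add: m_def train_len_def)
  show "set (B' j) \<noteq> {}" using c fold_size(2) by auto
qed

lemma f_meas [measurable]: "case_prod f \<in> borel_measurable (P \<Otimes>\<^sub>M K)"
  unfolding f_def by measurable

lemma integrable_g: "integrable P g"
proof -
  have "integrable P (\<lambda>z. (g z)\<^sup>2)"
    unfolding P_def using g_sq integrable_distr_eq[OF measurable_Z[of 0], of "\<lambda>z. (g z)\<^sup>2"] by simp
  then show ?thesis by (rule P.square_integrable_imp_integrable[rotated]) simp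
qed

lemma expectation_g: "expectation (\<lambda>\<omega>. g (Z i \<omega>)) = (\<integral>z. g z \<partial>P)"
  using integral_distr[OF measurable_Z g_meas] by (simp only: distr_N_Z)

lemma measurable_slice [measurable]: "slice_var P f \<in> borel_measurable K"
  by (rule P.measurable_slice_var[OF f_meas])

lemma measurable_Y [measurable]: "length bs = m \<Longrightarrow> subvec Z bs \<in> measurable M K"
  by (rule measurable_subvec) simp

lemma measurable_Y0 [measurable]: "Y0 \<in> measurable M K"
  unfolding Y0_def by (rule measurable_Y) simp

section \<open>Transfer between training vectors\<close>

lemma distr_Y:
  assumes "distinct bs" "length bs = m"
  shows "distr M K (subvec Z bs) = distr M K Y0"
proof -
  have ne: "[1..<Suc m] \<noteq> []" "bs \<noteq> []" using train_len_pos assms by auto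
  have l: "length [1..<Suc m] = m" by simp
  show ?thesis
    using distr_subvec[OF assms(1) ne(2)] distr_subvec[OF distinct_upt ne(1)]
    unfolding Y0_def l assms(2) by (rule trans[OF _ sym])
qed

lemma nn_integral_Y:
  assumes bs: "distinct bs" "length bs = m" and \<phi>: "\<phi> \<in> borel_measurable K"
  shows "(\<integral>\<^sup>+ \<omega>. \<phi> (subvec Z bs \<omega>) \<partial>M) = (\<integral>\<^sup>+ \<omega>. \<phi> (Y0 \<omega>) \<partial>M)"
  using nn_integral_distr[OF measurable_Y[OF bs(2)], of \<phi>] nn_integral_distr[OF measurable_Y0, of \<phi>] \<phi>
  unfolding distr_Y[OF bs] by simp

text \<open>The indices of \<open>Y0\<close> start at 1, so \<open>Z 0\<close> is a fresh test
  point.\<close>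

sublocale Y0: indep_pair M P K "Z 0" Y0
proof -
  have "0 \<notin> set [1..<Suc m]" "length [1..<Suc m] = m" by auto
  then show "indep_pair M P K (Z 0) Y0"
    using indep_pair_single[of 0 "[1..<Suc m]"] unfolding Y0_def by metis
qed

lemma sigma_Y0: "sigma_subvec M N Z [1..<Suc m] = Y0.\<F>"
  by (simp add: sigma_subvec_def Y0_def del: upt_Suc)

text \<open>The assumption on the conditional absolute moment concerns \<open>Y0\<close>. By
  freezing it becomes a property of almost every \<open>v\<close> under the law of
  \<open>Y0\<close>, which is also the law of every other training vector of this length.\<close>

lemma AE_integrable_h:
  assumes bs: "distinct bs" "length bs = m"
  shows "AE \<omega> in M. integrable P (\<lambda>z. h z (subvec Z bs \<omega>))"
proof -
  note [measurable] = measurable_Y[OF bs(2)]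
  have "AE \<omega> in M. nn_cond_exp M Y0.\<F> (\<lambda>\<omega>'. ennreal \<bar>h (Z 0 \<omega>') (Y0 \<omega>')\<bar>) \<omega>
      = (\<integral>\<^sup>+ z. ennreal \<bar>h z (Y0 \<omega>)\<bar> \<partial>P)"
    by (rule Y0.nn_cond_exp_pair[where f = "\<lambda>z v. ennreal \<bar>h z v\<bar>"]) measurable
  with h_cond_exp have "AE \<omega> in M. (\<integral>\<^sup>+ z. ennreal \<bar>h z (Y0 \<omega>)\<bar> \<partial>P) < \<infinity>"
    unfolding sigma_Y0 by eventually_elim simp
  then have "AE v in distr M K Y0. (\<integral>\<^sup>+ z. ennreal \<bar>h z v\<bar> \<partial>P) < \<infinity>"
    by (subst AE_distr_iff) auto
  then have "AE v in distr M K (subvec Z bs). (\<integral>\<^sup>+ z. ennreal \<bar>h z v\<bar> \<partial>P) < \<infinity>"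
    unfolding distr_Y[OF bs] .
  from AE_distrD[OF measurable_Y[OF bs(2)] this] AE_space show ?thesis
  proof eventually_elim
    case (elim \<omega>)
    have "subvec Z bs \<omega> \<in> space K"
      by (rule measurable_space[OF measurable_Y[OF bs(2)] elim(2)])
    then have "(\<lambda>z. h z (subvec Z bs \<omega>)) \<in> borel_measurable P" by measurable
    then show ?case using elim(1) by (intro integrableI_bounded) auto
  qed
qed

lemma AE_integrable_f:
  assumes bs: "distinct bs" "length bs = m"
  shows "AE \<omega> in M. integrable P (\<lambda>z. f z (subvec Z bs \<omega>))"
  using AE_integrable_h[OF bs] by eventually_elim (simp add: f_def integrable_g)

lemma var_Z0_AE_eq: "AE \<omega> in M. V \<omega> = slice_var P f (Y0 \<omega>)"
proof -
  have "AE \<omega> in M. integrable P (\<lambda>z. f z (Y0 \<omega>))"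
    unfolding Y0_def by (rule AE_integrable_f) auto
  from Y0.cond_var_pair[OF f_meas this] show ?thesis
    unfolding var_Z0_def sigma_Y0 by (simp only: f_def[abs_def] Y0_def)
qed

text \<open>Each conditional expectation equals a slice mean off a null set, and only finitely many
  pairs (i, j) occur. Integrability of the slices of \<open>h\<close> and of \<open>g\<close> lets
  the mean of the difference split.\<close>

lemma cv_stat_AE_eq: "AE \<omega> in M. T \<omega> = 1 / (\<sigma> * sqrt (real n)) * (\<Sum>j\<in>{1..k}. fold_sum j \<omega>)"
proof -
  let ?E = "\<lambda>i j. real_cond_exp M (sigma_subvec M N Z (B j)) (\<lambda>\<omega>'. h (Z i \<omega>') (subvec Z (B j) \<omega>'))"
  have "AE \<omega> in M. \<forall>j\<in>{1..k}. \<forall>i\<in>set (B' j).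
      h (Z i \<omega>) (subvec Z (B j) \<omega>) - ?E i j \<omega> - (g (Z i \<omega>) - expectation (\<lambda>\<omega>'. g (Z i \<omega>')))
      = centered P f (Z i \<omega>) (subvec Z (B j) \<omega>)"
  proof (intro AE_finite_allI ballI)
    fix i j assume j: "j \<in> {1..k}" and i: "i \<in> set (B' j)"
    note bs = distinct_B[OF j] length_B[OF j]
    have "i \<notin> set (B j)" using B'_B[OF j] i by auto
    then interpret Yj: indep_pair M P K "Z i" "subvec Z (B j)"
      using indep_pair_single[of i "B j"] by (simp add: bs)
    have sig: "sigma_subvec M N Z (B j) = Yj.\<F>" by (simp add: sigma_subvec_def bs)
    have hP: "case_prod h \<in> borel_measurable (P \<Otimes>\<^sub>M K)" by measurable
    show "AE \<omega> in M. h (Z i \<omega>) (subvec Z (B j) \<omega>) - ?E i j \<omega>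
        - (g (Z i \<omega>) - expectation (\<lambda>\<omega>'. g (Z i \<omega>')))
        = centered P f (Z i \<omega>) (subvec Z (B j) \<omega>)"
      using Yj.real_cond_exp_pair[OF hP AE_integrable_h[OF bs]] AE_integrable_h[OF bs]
      unfolding sig
      by eventually_elim (simp add: centered_def f_def expectation_g integrable_g)
  qed auto
  then show ?thesis
    by eventually_elim (simp add: cv_stat_def fold_sum_def)
qed

section \<open>Moment and tail bounds at a fixed sample size\<close>

lemma measurable_fold_sum [measurable]:
  assumes j: "j \<in> {1..k}"
  shows "fold_sum j \<in> borel_measurable M"
proof -
  note [measurable] = measurable_Y[OF length_B[OF j]] P.measurable_centered[OF f_meas]
  show ?thesis unfolding fold_sum_def by measurable
qed

text \<open>The bound from freezing involves only the law of the training vector, so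
  \<open>B j\<close> can be exchanged for \<open>Y0\<close> and the result is the same for all
  folds. The factor n/k is the fold size.\<close>

lemma fold_sum_moment_le:
  assumes j: "j \<in> {1..k}" and p: "0 < p" "p \<le> 2" and c [measurable]: "c \<in> borel_measurable K"
  shows "(\<integral>\<^sup>+ \<omega>. ennreal (\<bar>fold_sum j \<omega>\<bar> powr p) * c (subvec Z (B j) \<omega>) \<partial>M)
    \<le> ennreal ((real n / real k) powr (p / 2)) * (\<integral>\<^sup>+ \<omega>. epowr (slice_var P f (Y0 \<omega>)) (p / 2) * c (Y0 \<omega>) \<partial>M)"
proof -
  note bs = distinct_B[OF j] length_B[OF j]
  have "(\<integral>\<^sup>+ \<omega>. ennreal (\<bar>fold_sum j \<omega>\<bar> powr p) * c (subvec Z (B j) \<omega>) \<partial>M)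
    \<le> (\<integral>\<^sup>+ \<omega>. epowr (ennreal (real n / real k) * slice_var P f (subvec Z (B j) \<omega>)) (p / 2) * c (subvec Z (B j) \<omega>) \<partial>M)"
    using fold_moment_le[OF _ B'_ne[OF j] B'_B[OF j] bs(2) f_meas c AE_integrable_f[OF bs] p]
    by (simp add: fold_sum_def card_B'[OF j] fold_size)
  also have "\<dots> = (\<integral>\<^sup>+ \<omega>. epowr (ennreal (real n / real k) * slice_var P f (Y0 \<omega>)) (p / 2) * c (Y0 \<omega>) \<partial>M)"
    by (rule nn_integral_Y[OF bs, where \<phi> = "\<lambda>v. epowr (ennreal (real n / real k) * slice_var P f v) (p / 2) * c v"]) measurable
  also have "\<dots> = (\<integral>\<^sup>+ \<omega>. ennreal ((real n / real k) powr (p / 2)) * (epowr (slice_var P f (Y0 \<omega>)) (p / 2) * c (Y0 \<omega>)) \<partial>M)"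
    using n_pos k_ge by (simp add: epowr_cmult mult.assoc)
  also have "\<dots> = ennreal ((real n / real k) powr (p / 2)) * (\<integral>\<^sup>+ \<omega>. epowr (slice_var P f (Y0 \<omega>)) (p / 2) * c (Y0 \<omega>) \<partial>M)"
    by (rule nn_integral_cmult) measurable
  finally show ?thesis .
qed

lemma moment_bound:
  assumes q: "0 < q" "q \<le> 2"
  shows "(\<integral>\<^sup>+ \<omega>. ennreal (\<bar>T \<omega>\<bar> powr q) \<partial>M)
    \<le> ennreal (max (real k powr (q / 2)) (real k powr (1 - q / 2))) *
       (\<integral>\<^sup>+ \<omega>. epowr (ennreal (1 / \<sigma>\<^sup>2) * V \<omega>) (q / 2) \<partial>M)"
proof -
  define s where "s = \<sigma> * sqrt (real n)"
  have s: "0 < s" using \<sigma>_pos n_pos by (simp add: s_def)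
  have k: "1 \<le> real k" "0 < real k" using k_ge by auto
  \<comment> \<open>One constant for both regimes: subadditivity of t^q for q \<le> 1 and the
    power-mean inequality for q > 1.\<close>
  define C where "C = max 1 (real k powr (q - 1))"
  have C: "0 < C" by (simp add: C_def)
  define I where "I = (\<integral>\<^sup>+ \<omega>. epowr (slice_var P f (Y0 \<omega>)) (q / 2) \<partial>M)"
  have sum_fold_sum: "\<bar>\<Sum>j\<in>{1..k}. fold_sum j \<omega>\<bar> powr q \<le> C * (\<Sum>j\<in>{1..k}. \<bar>fold_sum j \<omega>\<bar> powr q)" for \<omega>
  proof -
    have "\<bar>\<Sum>j\<in>{1..k}. fold_sum j \<omega>\<bar> powr q \<le> (\<Sum>j\<in>{1..k}. \<bar>fold_sum j \<omega>\<bar>) powr q"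
      using q by (intro powr_mono2 sum_abs) auto
    also have "\<dots> \<le> C * (\<Sum>j\<in>{1..k}. \<bar>fold_sum j \<omega>\<bar> powr q)"
    proof (cases "q \<le> 1")
      case True
      have "(\<Sum>j\<in>{1..k}. \<bar>fold_sum j \<omega>\<bar>) powr q \<le> 1 * (\<Sum>j\<in>{1..k}. \<bar>fold_sum j \<omega>\<bar> powr q)"
        using powr_sum_le[of "{1..k}" "\<lambda>j. \<bar>fold_sum j \<omega>\<bar>" q] True q by simp
      also have "\<dots> \<le> C * (\<Sum>j\<in>{1..k}. \<bar>fold_sum j \<omega>\<bar> powr q)"
        by (intro mult_right_mono sum_nonneg) (auto simp: C_def)
      finally show ?thesis .
    next
      case False
      have "(\<Sum>j\<in>{1..k}. \<bar>fold_sum j \<omega>\<bar>) powr q \<le> real k powr (q - 1) * (\<Sum>j\<in>{1..k}. \<bar>fold_sum j \<omega>\<bar> powr q)"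
        using powr_sum_le_card[of "{1..k}" "\<lambda>j. \<bar>fold_sum j \<omega>\<bar>" q] False k_ge by simp
      also have "\<dots> \<le> C * (\<Sum>j\<in>{1..k}. \<bar>fold_sum j \<omega>\<bar> powr q)"
        by (intro mult_right_mono sum_nonneg) (auto simp: C_def)
      finally show ?thesis .
    qed
    finally show ?thesis .
  qed
  have "AE \<omega> in M. ennreal (\<bar>T \<omega>\<bar> powr q) \<le> ennreal (C / s powr q) * (\<Sum>j\<in>{1..k}. ennreal (\<bar>fold_sum j \<omega>\<bar> powr q))"
    using cv_stat_AE_eq
  proof eventually_elim
    case (elim \<omega>)
    have "\<bar>T \<omega>\<bar> powr q = \<bar>\<Sum>j\<in>{1..k}. fold_sum j \<omega>\<bar> powr q / s powr q"
      using s by (simp add: elim abs_mult powr_divide flip: s_def)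
    also have "\<dots> \<le> C * (\<Sum>j\<in>{1..k}. \<bar>fold_sum j \<omega>\<bar> powr q) / s powr q"
      by (intro divide_right_mono sum_fold_sum) simp
    finally have "\<bar>T \<omega>\<bar> powr q \<le> C / s powr q * (\<Sum>j\<in>{1..k}. \<bar>fold_sum j \<omega>\<bar> powr q)" by simp
    then show ?case
      using C s by (simp add: sum_ennreal sum_nonneg flip: ennreal_mult)
  qed
  then have "(\<integral>\<^sup>+ \<omega>. ennreal (\<bar>T \<omega>\<bar> powr q) \<partial>M)
      \<le> (\<integral>\<^sup>+ \<omega>. ennreal (C / s powr q) * (\<Sum>j\<in>{1..k}. ennreal (\<bar>fold_sum j \<omega>\<bar> powr q)) \<partial>M)"
    by (rule nn_integral_mono_AE)
  also have "\<dots> = ennreal (C / s powr q) * (\<Sum>j\<in>{1..k}. \<integral>\<^sup>+ \<omega>. ennreal (\<bar>fold_sum j \<omega>\<bar> powr q) \<partial>M)"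
    by (subst nn_integral_cmult, measurable, subst nn_integral_sum) auto
  also have "\<dots> \<le> ennreal (C / s powr q) * (\<Sum>j\<in>{1..k}. ennreal ((real n / real k) powr (q / 2)) * I)"
    using fold_sum_moment_le[OF _ q, where c = "\<lambda>_. 1"] by (intro mult_left_mono sum_mono) (auto simp: I_def)
  also have "\<dots> = ennreal (C / s powr q * (real k * (real n / real k) powr (q / 2))) * I"
    using C s by (simp add: ennreal_mult mult.assoc ennreal_of_nat_eq_real_of_nat del: times_divide_eq_left times_divide_eq_right)
  \<comment> \<open>The powers of n cancel against s^q, and C k^(1-q/2) is the maximum of k^(1-q/2)
    and k^(q/2).\<close>
  also have "C / s powr q * (real k * (real n / real k) powr (q / 2))
      = max (real k powr (q / 2)) (real k powr (1 - q / 2)) * (1 / \<sigma>\<^sup>2) powr (q / 2)"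
  proof -
    have "max (real k powr (q / 2)) (real k powr (1 - q / 2)) = C * real k powr (1 - q / 2)"
      using k by (simp add: C_def max_mult_distrib_right max.commute flip: powr_add)
    then have max: "max (real k powr (q / 2)) (real k powr (1 - q / 2))
        = C * (real k / real k powr (q / 2))"
      using k by (simp add: powr_diff)
    have s_powr: "s powr q = (\<sigma>\<^sup>2) powr (q / 2) * real n powr (q / 2)"
    proof -
      have "s powr q = (s powr 2) powr (q / 2)" by (simp add: powr_powr)
      also have "s powr 2 = \<sigma>\<^sup>2 * real n" using s by (simp add: s_def power_mult_distrib)
      finally show ?thesis using \<sigma>_pos by (simp add: powr_mult)
    qed
    show ?thesis
      unfolding max s_powr using k n_pos \<sigma>_pos by (simp add: powr_divide field_simps)
  qed
  also have "ennreal (max (real k powr (q / 2)) (real k powr (1 - q / 2)) * (1 / \<sigma>\<^sup>2) powr (q / 2)) * I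
    = ennreal (max (real k powr (q / 2)) (real k powr (1 - q / 2))) * (ennreal ((1 / \<sigma>\<^sup>2) powr (q / 2)) * I)"
    by (subst ennreal_mult) (auto simp: mult.assoc le_max_iff_disj)
  also have "ennreal ((1 / \<sigma>\<^sup>2) powr (q / 2)) * I
      = (\<integral>\<^sup>+ \<omega>. ennreal ((1 / \<sigma>\<^sup>2) powr (q / 2)) * epowr (slice_var P f (Y0 \<omega>)) (q / 2) \<partial>M)"
    unfolding I_def by (rule nn_integral_cmult[symmetric]) measurable
  also have "\<dots> = (\<integral>\<^sup>+ \<omega>. epowr (ennreal (1 / \<sigma>\<^sup>2) * V \<omega>) (q / 2) \<partial>M)"
    using var_Z0_AE_eq \<sigma>_pos by (intro nn_integral_cong_AE) (auto simp: epowr_cmult)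
  finally show ?thesis .
qed

text \<open>The truncation level \<open>k\<close> is chosen so that a union bound over
  \<open>k\<close> folds costs k P(r > k), which is the part of E min(k, r) on the event r > k. The
  remaining folds are handled by a first-moment bound.\<close>

lemma tail_bound:
  assumes \<epsilon>: "0 < \<epsilon>"
  shows "ennreal (measure M {\<omega> \<in> space M. \<epsilon> < \<bar>T \<omega>\<bar>})
    \<le> ennreal (1 + 1 / \<epsilon>) * (\<integral>\<^sup>+ \<omega>. min (of_nat k) (ennreal (sqrt (real k) / \<sigma>) * epowr (V \<omega>) (1 / 2)) \<partial>M)"
proof -
  define s where "s = \<sigma> * sqrt (real n)"
  have s: "0 < s" using \<sigma>_pos n_pos by (simp add: s_def)
  define r where "r v = ennreal (sqrt (real k) / \<sigma>) * epowr (slice_var P f v) (1 / 2)" for v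
  have [measurable]: "r \<in> borel_measurable K" unfolding r_def by measurable
  \<comment> \<open>\<open>b\<close> and \<open>c\<close> are complementary indicators, of training
    data with r > k and r \<le> k. Both are functions of the training vector, so \<open>c\<close>
    can serve as the weight in the fold moment bound.\<close>
  define b :: "(nat \<Rightarrow> 'z) \<Rightarrow> ennreal" where "b v = (if of_nat k < r v then 1 else 0)" for v
  define c :: "(nat \<Rightarrow> 'z) \<Rightarrow> ennreal" where "c v = (if of_nat k < r v then 0 else 1)" for v
  have b [measurable]: "b \<in> borel_measurable K" unfolding b_def by measurable
  have c [measurable]: "c \<in> borel_measurable K" unfolding c_def by measurable
  have bY: "(\<integral>\<^sup>+ \<omega>. b (subvec Z (B j) \<omega>) \<partial>M) = (\<integral>\<^sup>+ \<omega>. b (Y0 \<omega>) \<partial>M)" if "j \<in> {1..k}" for j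
    using that by (intro nn_integral_Y distinct_B length_B b)
  have [measurable]: "(\<lambda>\<omega>. b (subvec Z (B j) \<omega>)) \<in> borel_measurable M"
    "(\<lambda>\<omega>. c (subvec Z (B j) \<omega>)) \<in> borel_measurable M" if "j \<in> {1..k}" for j
    using measurable_compose[OF measurable_Y[OF length_B[OF that]] b]
      measurable_compose[OF measurable_Y[OF length_B[OF that]] c] by auto
  let ?A = "{\<omega> \<in> space M. \<epsilon> < \<bar>T \<omega>\<bar>}"
  have T_meas: "T \<in> borel_measurable M"
  proof -
    have "real_cond_exp M F X \<in> borel_measurable M" for F and X :: "'a \<Rightarrow> real"
      by (rule borel_measurable_cond_exp2)
    moreover have "(\<lambda>\<omega>. h (Z i \<omega>) (subvec Z (B j) \<omega>)) \<in> borel_measurable M" if "j \<in> {1..k}" for i j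
    proof -
      note [measurable] = measurable_Y[OF length_B[OF that]]
      show ?thesis by measurable
    qed
    ultimately show ?thesis
      unfolding cv_stat_def[abs_def] by measurable
  qed
  then have A [measurable]: "?A \<in> sets M" by measurable
  \<comment> \<open>On the event, either some fold has r > k and the first sum is at least 1, or
    every \<open>c\<close> equals 1 and Markov's pointwise bound applies. The exponent 1 is kept to
    match the moment bound with p = 1.\<close>
  have "AE \<omega> in M. indicator ?A \<omega> \<le> (\<Sum>j\<in>{1..k}. b (subvec Z (B j) \<omega>))
      + ennreal (1 / (\<epsilon> * s)) * (\<Sum>j\<in>{1..k}. ennreal (\<bar>fold_sum j \<omega>\<bar> powr 1) * c (subvec Z (B j) \<omega>))"
    using cv_stat_AE_eq
  proof eventually_elim
    case (elim \<omega>)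
    show ?case
    proof (cases "\<omega> \<in> ?A")
      case True
      show ?thesis
      proof (cases "\<exists>j\<in>{1..k}. of_nat k < r (subvec Z (B j) \<omega>)")
        case ex: True
        then obtain j where j: "j \<in> {1..k}" "of_nat k < r (subvec Z (B j) \<omega>)" by blast
        then have "1 = b (subvec Z (B j) \<omega>)" by (simp add: b_def)
        also have "\<dots> \<le> (\<Sum>j\<in>{1..k}. b (subvec Z (B j) \<omega>))"
          using j by (intro member_le_sum) auto
        finally show ?thesis using True by (auto simp: add_increasing2)
      next
        case False
        have "\<epsilon> < \<bar>\<Sum>j\<in>{1..k}. fold_sum j \<omega>\<bar> / s"
          using True s by (simp add: elim abs_mult flip: s_def)
        also have "\<dots> \<le> (\<Sum>j\<in>{1..k}. \<bar>fold_sum j \<omega>\<bar>) / s"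
          using s by (intro divide_right_mono sum_abs) auto
        finally have "1 \<le> 1 / (\<epsilon> * s) * (\<Sum>j\<in>{1..k}. \<bar>fold_sum j \<omega>\<bar>)"
          using \<epsilon> s by (simp add: field_simps)
        then have "ennreal 1 \<le> ennreal (1 / (\<epsilon> * s) * (\<Sum>j\<in>{1..k}. \<bar>fold_sum j \<omega>\<bar>))"
          by (rule ennreal_leI)
        also have "\<dots> = ennreal (1 / (\<epsilon> * s)) * (\<Sum>j\<in>{1..k}. ennreal \<bar>fold_sum j \<omega>\<bar>)"
          using \<epsilon> s by (subst sum_ennreal, simp, intro ennreal_mult sum_nonneg) auto
        also have "(\<Sum>j\<in>{1..k}. ennreal \<bar>fold_sum j \<omega>\<bar>)
            = (\<Sum>j\<in>{1..k}. ennreal (\<bar>fold_sum j \<omega>\<bar> powr 1) * c (subvec Z (B j) \<omega>))"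
          using False by (intro sum.cong) (auto simp: c_def)
        finally show ?thesis using True by (auto simp: add_increasing)
      qed
    qed simp
  qed
  then have "(\<integral>\<^sup>+ \<omega>. indicator ?A \<omega> \<partial>M) \<le> (\<integral>\<^sup>+ \<omega>. (\<Sum>j\<in>{1..k}. b (subvec Z (B j) \<omega>))
      + ennreal (1 / (\<epsilon> * s)) * (\<Sum>j\<in>{1..k}. ennreal (\<bar>fold_sum j \<omega>\<bar> powr 1) * c (subvec Z (B j) \<omega>)) \<partial>M)"
    by (rule nn_integral_mono_AE)
  also have "\<dots> = (\<Sum>j\<in>{1..k}. \<integral>\<^sup>+ \<omega>. b (subvec Z (B j) \<omega>) \<partial>M)
      + ennreal (1 / (\<epsilon> * s)) * (\<Sum>j\<in>{1..k}. \<integral>\<^sup>+ \<omega>. ennreal (\<bar>fold_sum j \<omega>\<bar> powr 1) * c (subvec Z (B j) \<omega>) \<partial>M)"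
    by (subst nn_integral_add, measurable, subst nn_integral_cmult, measurable, subst (1 2) nn_integral_sum) auto
  also have "\<dots> \<le> (\<Sum>j\<in>{1..k}. \<integral>\<^sup>+ \<omega>. b (Y0 \<omega>) \<partial>M)
      + ennreal (1 / (\<epsilon> * s)) * (\<Sum>j\<in>{1..k}. ennreal ((real n / real k) powr (1 / 2)) *
          (\<integral>\<^sup>+ \<omega>. epowr (slice_var P f (Y0 \<omega>)) (1 / 2) * c (Y0 \<omega>) \<partial>M))"
    using fold_sum_moment_le[OF _ _ _ c, of _ 1] bY
    by (intro add_mono mult_left_mono sum_mono) auto
  also have "\<dots> = of_nat k * (\<integral>\<^sup>+ \<omega>. b (Y0 \<omega>) \<partial>M)
      + ennreal (1 / (\<epsilon> * s) * (real k * (real n / real k) powr (1 / 2))) *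
          (\<integral>\<^sup>+ \<omega>. epowr (slice_var P f (Y0 \<omega>)) (1 / 2) * c (Y0 \<omega>) \<partial>M)"
    using \<epsilon> s by (simp add: ennreal_mult mult.assoc ennreal_of_nat_eq_real_of_nat del: times_divide_eq_left times_divide_eq_right)
  \<comment> \<open>Summing \<open>k\<close> folds of scale sqrt(n/k) gives sqrt(n k), and
    normalization removes n; the coefficient in \<open>r\<close> appears.\<close>
  also have "1 / (\<epsilon> * s) * (real k * (real n / real k) powr (1 / 2)) = 1 / \<epsilon> * (sqrt (real k) / \<sigma>)"
    using \<epsilon> \<sigma>_pos n_pos k_ge
    by (simp add: s_def powr_half_sqrt real_sqrt_divide field_simps)
  also have "ennreal (1 / \<epsilon> * (sqrt (real k) / \<sigma>)) = ennreal (1 / \<epsilon>) * ennreal (sqrt (real k) / \<sigma>)"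
    using \<epsilon> \<sigma>_pos by (intro ennreal_mult) auto
  also have "of_nat k * (\<integral>\<^sup>+ \<omega>. b (Y0 \<omega>) \<partial>M) + ennreal (1 / \<epsilon>) * ennreal (sqrt (real k) / \<sigma>) *
          (\<integral>\<^sup>+ \<omega>. epowr (slice_var P f (Y0 \<omega>)) (1 / 2) * c (Y0 \<omega>) \<partial>M)
      = (\<integral>\<^sup>+ \<omega>. of_nat k * b (Y0 \<omega>) + ennreal (1 / \<epsilon>) * (r (Y0 \<omega>) * c (Y0 \<omega>)) \<partial>M)"
    by (subst nn_integral_add, measurable) (simp add: nn_integral_cmult r_def mult.assoc)
  also have "\<dots> \<le> (\<integral>\<^sup>+ \<omega>. ennreal (1 + 1 / \<epsilon>) * min (of_nat k) (r (Y0 \<omega>)) \<partial>M)"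
  proof (rule nn_integral_mono)
    fix \<omega>
    have *: "ennreal (1 + 1 / \<epsilon>) = 1 + ennreal (1 / \<epsilon>)" using \<epsilon> by simp
    show "of_nat k * b (Y0 \<omega>) + ennreal (1 / \<epsilon>) * (r (Y0 \<omega>) * c (Y0 \<omega>))
        \<le> ennreal (1 + 1 / \<epsilon>) * min (of_nat k) (r (Y0 \<omega>))"
      \<comment> \<open>For r > k only the first term survives and equals k = min(k, r); otherwise
        only the second does and equals r/\<epsilon> with r = min(k, r). Both coefficients are at
        most 1 + 1/\<epsilon>.\<close>
      by (cases "of_nat k < r (Y0 \<omega>)")
        (auto simp: b_def c_def * distrib_right min_def not_less add_increasing add_increasing2 simp del: ennreal_plus)
  qed
  also have "\<dots> = ennreal (1 + 1 / \<epsilon>) * (\<integral>\<^sup>+ \<omega>. min (of_nat k) (r (Y0 \<omega>)) \<partial>M)"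
    by (rule nn_integral_cmult) measurable
  also have "(\<integral>\<^sup>+ \<omega>. min (of_nat k) (r (Y0 \<omega>)) \<partial>M)
      = (\<integral>\<^sup>+ \<omega>. min (of_nat k) (ennreal (sqrt (real k) / \<sigma>) * epowr (V \<omega>) (1 / 2)) \<partial>M)"
    using var_Z0_AE_eq by (intro nn_integral_cong_AE) (auto simp: r_def)
  finally show ?thesis by (simp add: emeasure_eq_measure)
qed

end

section \<open>Passage to the limit\<close>

text \<open>\<open>S\<close> collects the admissible sample sizes, and the filter
  \<open>inf sequentially (principal S)\<close> is n tending to infinity within \<open>S\<close>; it
  is proper because \<open>S\<close> is infinite. Finiteness of the conditional absolute moment of
  \<open>h n\<close> expresses that the conditional expectations are well defined.\<close>

theorem theorem3:
  fixes M :: "'a measure" and N :: "'z measure"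
    and Z :: "nat \<Rightarrow> 'a \<Rightarrow> 'z"
    and S :: "nat set"
    and k :: "nat \<Rightarrow> nat"
    and B B' :: "nat \<Rightarrow> nat \<Rightarrow> nat list"
    and h :: "nat \<Rightarrow> 'z \<Rightarrow> (nat \<Rightarrow> 'z) \<Rightarrow> real"
    and hbar :: "nat \<Rightarrow> 'z \<Rightarrow> real"
    and \<sigma> :: "nat \<Rightarrow> real"
    and T :: "nat \<Rightarrow> 'a \<Rightarrow> real"
    and V :: "nat \<Rightarrow> 'a \<Rightarrow> ennreal"
  assumes M: "prob_space M"
    and indep: "prob_space.indep_vars M (\<lambda>_. N) Z UNIV"
    and ident: "\<And>i. distr M N (Z i) = distr M N (Z 0)"
    and S: "infinite S" "0 \<notin> S"
    and k: "\<And>n. n \<in> S \<Longrightarrow> 2 \<le> k n" "\<And>n. n \<in> S \<Longrightarrow> k n dvd n"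
    and splits: "\<And>n. n \<in> S \<Longrightarrow> cv_splits n (k n) (B n) (B' n)"
    and h_meas: "\<And>n. n \<in> S \<Longrightarrow>
          (\<lambda>(z, v). h n z v) \<in> borel_measurable (N \<Otimes>\<^sub>M vec_space N (train_len n (k n)))"
    and h_cond_exp: "\<And>n. n \<in> S \<Longrightarrow>
          (AE \<omega> in M. nn_cond_exp M (sigma_subvec M N Z [1..<Suc (train_len n (k n))])
             (\<lambda>\<omega>'. ennreal \<bar>h n (Z 0 \<omega>') (subvec Z [1..<Suc (train_len n (k n))] \<omega>')\<bar>) \<omega> < \<infinity>)"
    and hbar_meas: "\<And>n. n \<in> S \<Longrightarrow> hbar n \<in> borel_measurable N"
    and hbar_sq: "\<And>n. n \<in> S \<Longrightarrow> integrable M (\<lambda>\<omega>. (hbar n (Z 0 \<omega>))\<^sup>2)"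
    and \<sigma>_def: "\<And>n. n \<in> S \<Longrightarrow> \<sigma> n = sqrt (prob_space.variance M (\<lambda>\<omega>. hbar n (Z 0 \<omega>)))"
    and \<sigma>_pos: "\<And>n. n \<in> S \<Longrightarrow> 0 < \<sigma> n"
    and T_def: "\<And>n. n \<in> S \<Longrightarrow>
          T n = cv_stat M N Z n (k n) (B n) (B' n) (h n) (hbar n) (\<sigma> n)"
    and V_def: "\<And>n. n \<in> S \<Longrightarrow> V n = var_Z0 M N Z (train_len n (k n)) (h n) (hbar n)"
  shows "(\<forall>q. 0 < q \<and> q \<le> 2 \<longrightarrow>
            ((\<lambda>n. ennreal (max (real (k n) powr (q / 2)) (real (k n) powr (1 - q / 2))) *
                  (\<integral>\<^sup>+ \<omega>. epowr (ennreal (1 / (\<sigma> n)\<^sup>2) * V n \<omega>) (q / 2) \<partial>M))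
               \<longlongrightarrow> 0) (inf sequentially (principal S)) \<longrightarrow>
            ((\<lambda>n. \<integral>\<^sup>+ \<omega>. ennreal (\<bar>T n \<omega>\<bar> powr q) \<partial>M)
               \<longlongrightarrow> 0) (inf sequentially (principal S))) \<and>
         (((\<lambda>n. \<integral>\<^sup>+ \<omega>. min (of_nat (k n))
                        (ennreal (sqrt (real (k n)) / \<sigma> n) * epowr (V n \<omega>) (1 / 2)) \<partial>M)
             \<longlongrightarrow> 0) (inf sequentially (principal S)) \<longrightarrow>
          (\<forall>\<epsilon>>0. ((\<lambda>n. measure M {\<omega> \<in> space M. \<epsilon> < \<bar>T n \<omega>\<bar>})
             \<longlongrightarrow> 0) (inf sequentially (principal S))))"
proof (intro conjI allI impI)
  interpret iid_sample M N Z
    using M indep ident by (intro iid_sample.intro iid_sample_axioms.intro) auto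
  have cv: "cv_setting M N Z n (k n) (B n) (B' n) (h n) (hbar n) (\<sigma> n)" if n: "n \<in> S" for n
    using n S(2) k[OF n] splits[OF n] h_meas[OF n] h_cond_exp[OF n] hbar_meas[OF n] hbar_sq[OF n] \<sigma>_pos[OF n]
    by unfold_locales (auto simp del: upt_Suc intro: gr0I)
  let ?F = "inf sequentially (principal S)"
  {
    fix q :: real
    assume q: "0 < q \<and> q \<le> 2"
    let ?R = "\<lambda>n. ennreal (max (real (k n) powr (q / 2)) (real (k n) powr (1 - q / 2))) *
                  (\<integral>\<^sup>+ \<omega>. epowr (ennreal (1 / (\<sigma> n)\<^sup>2) * V n \<omega>) (q / 2) \<partial>M)"
    assume lim: "(?R \<longlongrightarrow> 0) ?F"
    show "((\<lambda>n. \<integral>\<^sup>+ \<omega>. ennreal (\<bar>T n \<omega>\<bar> powr q) \<partial>M) \<longlongrightarrow> 0) ?F"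
    proof (rule tendsto_sandwich[OF _ _ tendsto_const lim])
      show "\<forall>\<^sub>F n in ?F. (\<integral>\<^sup>+ \<omega>. ennreal (\<bar>T n \<omega>\<bar> powr q) \<partial>M) \<le> ?R n"
        using cv_setting.moment_bound[OF cv, of _ q] q
        by (auto simp: eventually_inf_principal T_def V_def intro!: always_eventually)
    qed simp
  }
  {
    fix \<epsilon> :: real
    assume \<epsilon>: "0 < \<epsilon>"
    let ?R = "\<lambda>n. \<integral>\<^sup>+ \<omega>. min (of_nat (k n)) (ennreal (sqrt (real (k n)) / \<sigma> n) * epowr (V n \<omega>) (1 / 2)) \<partial>M"
    assume "(?R \<longlongrightarrow> 0) ?F"
    \<comment> \<open>For fixed \<epsilon> the factor 1 + 1/\<epsilon> is finite, so the product
      still tends to 0 in the extended half-line.\<close>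
    then have lim: "((\<lambda>n. ennreal (1 + 1 / \<epsilon>) * ?R n) \<longlongrightarrow> 0) ?F"
      using ennreal_tendsto_cmult[of "ennreal (1 + 1 / \<epsilon>)" ?R 0 ?F] by simp
    have "((\<lambda>n. ennreal (measure M {\<omega> \<in> space M. \<epsilon> < \<bar>T n \<omega>\<bar>})) \<longlongrightarrow> 0) ?F"
    proof (rule tendsto_sandwich[OF _ _ tendsto_const lim])
      show "\<forall>\<^sub>F n in ?F. ennreal (measure M {\<omega> \<in> space M. \<epsilon> < \<bar>T n \<omega>\<bar>}) \<le> ennreal (1 + 1 / \<epsilon>) * ?R n"
        using cv_setting.tail_bound[OF cv \<epsilon>]
        by (auto simp: eventually_inf_principal T_def V_def intro!: always_eventually)
    qed simp
    then show "((\<lambda>n. measure M {\<omega> \<in> space M. \<epsilon> < \<bar>T n \<omega>\<bar>}) \<longlongrightarrow> 0) ?F"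
      using tendsto_ennreal_iff[of "\<lambda>n. measure M {\<omega> \<in> space M. \<epsilon> < \<bar>T n \<omega>\<bar>}" ?F 0] by simp
  }
qed

end
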